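(* Let $\mu$ be a finite (nonnegative) Borel measure on $\mathbb{R}$. Let $F:[0,+\infty)\to\mathbb{R}$ be a function with $\lim_{r\to+\infty}F(r)=0$ such that $K(x,y)=F(|x-y|)$, $x,y\in\mathbb{R}$, is a positive semidefinite kernel on $\mathbb{R}\times\mathbb{R}$ which is not identically zero. Then there does not exist any Mercer expansion of $K$ over $\mathbb{R}\times\mathbb{R}=\mathbb{R}^2$ with respect to $\mu$ whose eigenfunctions $\psi_k$ all belong to a ball of $\mathcal{L}_\infty$; that is, there is no Mercer expansion of $K$ with respect to $\mu$ for which there exists $M<+\infty$ with $\|\psi_k\|_\infty:=\sup_{x\in\mathbb{R}}|\psi_k(x)|\le M$ for all $k$.
   Context: A positive semidefinite kernel on $\mathbb{R}\times\mathbb{R}$ is a symmetric function $K:\mathbb{R}\times\mathbb{R}\to\mathbb{R}$ such that $\sum_{i=1}^n\sum_{j=1}^n a_ia_jK(x_i,x_j)\ge 0$ for all integers $n\ge1$, all real $a_1,\dots,a_n$ and all $x_1,\dots,x_n\in\mathbb{R}$. A Mercer expansion of $K$ over $\mathbb{R}\times\mathbb{R}$ with respect to $\mu$ consists of real numbers $\lambda_k\ge0$ (eigenvalues) and functions $\psi_k:\mathbb{R}\to\mathbb{R}$ (eigenfunctions), $k=1,2,3,\dots$, such that: (1) $K(x,y)=\sum_{k=1}^{+\infty}\lambda_k\psi_k(x)\psi_k(y)$ for all $x,y\in\mathbb{R}$, with pointwise convergence; (2) $\lambda_k\psi_k(x)=\int_{\mathbb{R}}K(x,y)\psi_k(y)\,d\mu(y)$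 for all $x\in\mathbb{R}$ and all $k$; (3) the functions $\psi_k$ are orthonormal in $\mathcal{L}^2_\mu$, i.e. $\int_{\mathbb{R}}\psi_j\psi_k\,d\mu$ equals $1$ if $j=k$ and $0$ otherwise. *)

theory Defs
  imports "HOL-Analysis.Analysis"
begin

definition psd_kernel :: "(real \<Rightarrow> real \<Rightarrow> real) \<Rightarrow> bool" where
  "psd_kernel K \<longleftrightarrow>
     (\<forall>x y. K x y = K y x) \<and>
     (\<forall>n\<ge>1. \<forall>(a :: nat \<Rightarrow> real) (x :: nat \<Rightarrow> real).
        0 \<le> (\<Sum>i=1..n. \<Sum>j=1..n. a i * a j * K (x i) (x j)))"

text \<open>
  The infinite family of eigenpairs is indexed by \<open>0, 1, 2, \<dots>\<close> rather than \<open>1, 2, 3, \<dots>\<close>.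
  Using \<^const>\<open>has_bochner_integral\<close> makes existence of each integral part of the definition
  (the library integral of a non-integrable function is \<open>0\<close>). Together with measurability, the
  last conjunct for \<open>j = k\<close> says that \<open>psi k\<close> is square integrable.
\<close>

definition mercer_expansion ::
  "real measure \<Rightarrow> (real \<Rightarrow> real \<Rightarrow> real) \<Rightarrow> (nat \<Rightarrow> real) \<Rightarrow> (nat \<Rightarrow> real \<Rightarrow> real) \<Rightarrow> bool" where
  "mercer_expansion \<mu> K lam psi \<longleftrightarrow>
     (\<forall>k. 0 \<le> lam k) \<and>
     (\<forall>k. psi k \<in> borel_measurable \<mu>) \<and>
     (\<forall>x y. (\<lambda>k. lam k * psi k x * psi k y) sums K x y) \<and>
     (\<forall>k x. has_bochner_integral \<mu> (\<lambda>y. K x y * psi k y) (lam k * psi k x)) \<and>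
     (\<forall>j k. has_bochner_integral \<mu> (\<lambda>x. psi j x * psi k x) (if j = k then 1 else 0))"

text \<open>Extended-real valued, so that unbounded functions get the value \<open>\<infinity>\<close>.\<close>

definition sup_norm :: "(real \<Rightarrow> real) \<Rightarrow> ereal" where
  "sup_norm f = (SUP x. ereal \<bar>f x\<bar>)"

end

theory Submission
  imports Defs
begin

text \<open>
  Integrating \<open>F 0 = (\<Sum>k. lam k * (psi k x)\<^sup>2)\<close> against \<open>\<mu>\<close> shows that \<open>\<Sum>k. lam k\<close> converges.
  For fixed \<open>k\<close>, \<open>lam k * psi k x = (\<integral>y. F \<bar>x - y\<bar> * psi k y \<partial>\<mu>)\<close> tends to \<open>0\<close> as \<open>x\<close> tends to
  infinity, by dominated convergence. If \<open>\<bar>psi k\<bar> \<le> B\<close> for all \<open>k\<close>, the series for \<open>F 0\<close> is dominated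
  by \<open>lam k * B\<^sup>2\<close> uniformly in \<open>x\<close>, so letting \<open>x\<close> tend to infinity gives \<open>F 0 = 0\<close>, hence \<open>K = 0\<close>.
\<close>

lemma abs_le_of_sup_norm_le:
  assumes "sup_norm f \<le> M" and "M < \<infinity>"
  shows "\<bar>f x\<bar> \<le> real_of_ereal M"
proof -
  have "ereal \<bar>f x\<bar> \<le> sup_norm f"
    unfolding sup_norm_def by (rule SUP_upper) simp
  then have "ereal \<bar>f x\<bar> \<le> M" using assms(1) by (rule order_trans)
  \<comment> \<open>\<open>real_of_ereal\<close> is 0 at both infinities, but \<open>M\<close> is
    finite here: \<open>M = -\<infinity>\<close> contradicts
    \<open>ereal \<bar>f x\<bar> \<le> M\<close>.\<close>
  then show ?thesis using assms(2) by (cases M) auto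
qed

context
  fixes \<mu> K lam psi
  assumes exp: "mercer_expansion \<mu> K lam psi"
begin

lemma mercer_expansion_diag_sums: "(\<lambda>k. lam k * (psi k x)\<^sup>2) sums K x x"
  using exp unfolding mercer_expansion_def by (simp add: power2_eq_square mult.assoc)

text \<open>Termwise AM-GM in the expansion. When the diagonal is constant, this bounds
  \<open>K\<close> uniformly and so provides the majorant for dominated convergence.\<close>

lemma mercer_expansion_abs_le: "\<bar>K x y\<bar> \<le> (K x x + K y y) / 2"
proof -
  have K: "(\<lambda>k. lam k * psi k x * psi k y) sums K x y" and lam: "\<And>k. 0 \<le> lam k"
    using exp unfolding mercer_expansion_def by auto
  have diag: "(\<lambda>k. (lam k * (psi k x)\<^sup>2 + lam k * (psi k y)\<^sup>2) / 2) sums ((K x x + K y y) / 2)"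
    by (intro sums_divide sums_add mercer_expansion_diag_sums)
  have le: "\<bar>lam k * psi k x * psi k y\<bar> \<le> (lam k * (psi k x)\<^sup>2 + lam k * (psi k y)\<^sup>2) / 2" for k
  proof -
    have "2 * (\<bar>psi k x\<bar> * \<bar>psi k y\<bar>) \<le> (psi k x)\<^sup>2 + (psi k y)\<^sup>2"
      using sum_squares_bound[of "\<bar>psi k x\<bar>" "\<bar>psi k y\<bar>"] by simp
    from mult_left_mono[OF this lam[of k]] show ?thesis
      using lam[of k] by (simp add: abs_mult algebra_simps)
  qed
  have "K x y \<le> (K x x + K y y) / 2"
    by (rule sums_le[OF _ K diag]) (use le abs_le_D1 in blast)
  moreover have "- K x y \<le> (K x x + K y y) / 2"
    by (rule sums_le[OF _ sums_minus[OF K] diag]) (use le abs_le_D2 in blast)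
  ultimately show ?thesis by simp
qed

text \<open>Since each \<open>(psi k)\<^sup>2\<close> has integral 1, a partial sum of
  \<open>lam\<close> is the integral of a partial sum of the diagonal series. The latter is at most
  \<open>c\<close>, whose integral is finite because \<mu> is.\<close>

lemma mercer_expansion_summable_eigenvalues:
  assumes "finite_measure \<mu>" and "\<And>x. K x x = c"
  shows "summable lam"
proof (rule bounded_imp_summable)
  interpret finite_measure \<mu> by fact
  have lam: "0 \<le> lam k" for k
    using exp unfolding mercer_expansion_def by auto
  then show "0 \<le> lam k" for k .
  fix n
  have "has_bochner_integral \<mu> (\<lambda>x. psi k x * psi k x) 1" for k
    using exp unfolding mercer_expansion_def by (metis (full_types))
  then have int: "has_bochner_integral \<mu> (\<lambda>x. \<Sum>k\<le>n. lam k * (psi k x * psi k x)) (\<Sum>k\<le>n. lam k * 1)"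
    by (intro has_bochner_integral_sum has_bochner_integral_mult_right) auto
  have "(\<Sum>k\<le>n. lam k) = (\<integral>x. (\<Sum>k\<le>n. lam k * (psi k x * psi k x)) \<partial>\<mu>)"
    using has_bochner_integral_integral_eq[OF int] by simp
  also have "\<dots> \<le> (\<integral>x. c \<partial>\<mu>)"
  proof (rule integral_mono)
    show "integrable \<mu> (\<lambda>x. \<Sum>k\<le>n. lam k * (psi k x * psi k x))"
      using int by (rule integrable.intros)
    show "(\<Sum>k\<le>n. lam k * (psi k x * psi k x)) \<le> c" for x
      using sum_le_suminf[OF sums_summable[OF mercer_expansion_diag_sums[of x]], of "{..n}"]
        sums_unique[OF mercer_expansion_diag_sums[of x]] assms(2)[of x] lam
      by (simp add: power2_eq_square)
  qed simp
  finally show "(\<Sum>k\<le>n. lam k) \<le> (\<integral>x. c \<partial>\<mu>)" .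
qed

text \<open>The eigenvalue equation turns the claim into a limit of integrals; the constant
  \<open>c * B\<close> dominates and is integrable over a finite measure.\<close>

lemma mercer_expansion_eigenfunction_tendsto_0:
  fixes u :: "nat \<Rightarrow> real"
  assumes "finite_measure \<mu>"
    and "\<And>x y. \<bar>K x y\<bar> \<le> c" and "\<And>y. (\<lambda>n. K (u n) y) \<longlonglongrightarrow> 0"
    and "\<And>y. \<bar>psi k y\<bar> \<le> B"
  shows "(\<lambda>n. lam k * psi k (u n)) \<longlonglongrightarrow> 0"
proof -
  interpret finite_measure \<mu> by fact
  have int: "has_bochner_integral \<mu> (\<lambda>y. K x y * psi k y) (lam k * psi k x)" for x
    using exp unfolding mercer_expansion_def by auto
  have "0 \<le> c" using assms(2)[of 0 0] by linarith
  have "(\<lambda>n. \<integral>y. K (u n) y * psi k y \<partial>\<mu>) \<longlonglongrightarrow> (\<integral>y. 0 \<partial>\<mu>)"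
  proof (rule integral_dominated_convergence[where w = "\<lambda>_. c * B"])
    \<comment> \<open>Measurability of the product is part of the Bochner integrability in the
      eigenvalue equation.\<close>
    show "(\<lambda>y. K (u n) y * psi k y) \<in> borel_measurable \<mu>" for n
      using int by (metis borel_measurable_has_bochner_integral)
    show "AE y in \<mu>. (\<lambda>n. K (u n) y * psi k y) \<longlonglongrightarrow> 0"
      by (intro always_eventually allI tendsto_mult_left_zero assms(3))
    show "AE y in \<mu>. norm (K (u n) y * psi k y) \<le> c * B" for n
      using \<open>0 \<le> c\<close> assms(2,4) by (intro always_eventually allI) (simp add: abs_mult mult_mono)
  qed auto
  then show ?thesis using has_bochner_integral_integral_eq[OF int] by simp
qed

end

theorem corollary3:
  fixes \<mu> :: "real measure" and F :: "real \<Rightarrow> real" and K :: "real \<Rightarrow> real \<Rightarrow> real"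
  assumes "finite_measure \<mu>" and "sets \<mu> = sets borel"
    and "(F \<longlongrightarrow> 0) at_top"
    and "\<And>x y. K x y = F \<bar>x - y\<bar>"
    and "psd_kernel K"
    and "\<exists>x y. K x y \<noteq> 0"
  shows "\<not> (\<exists>lam psi. mercer_expansion \<mu> K lam psi \<and>
                      (\<exists>M<\<infinity>. \<forall>k. sup_norm (psi k) \<le> M))"
proof
  assume "\<exists>lam psi. mercer_expansion \<mu> K lam psi \<and> (\<exists>M<\<infinity>. \<forall>k. sup_norm (psi k) \<le> M)"
  then obtain lam psi M where exp: "mercer_expansion \<mu> K lam psi"
    and M: "M < \<infinity>" "\<And>k. sup_norm (psi k) \<le> M" by blast
  define B where "B = real_of_ereal M"
  have B: "\<bar>psi k x\<bar> \<le> B" for k x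
    unfolding B_def by (rule abs_le_of_sup_norm_le[OF M(2,1)])
  have lam: "0 \<le> lam k" for k
    using exp unfolding mercer_expansion_def by auto
  have diag: "K x x = F 0" for x by (simp add: assms(4))
  have bound: "\<bar>K x y\<bar> \<le> F 0" for x y
    using mercer_expansion_abs_le[OF exp, of x y] by (simp add: diag)
  have K_lim: "(\<lambda>n. K (real n) y) \<longlonglongrightarrow> 0" for y
  proof -
    have "filterlim (\<lambda>n. real n - y) at_top sequentially"
      using filterlim_tendsto_add_at_top[OF tendsto_const[of "- y"] filterlim_real_sequentially]
      by (simp add: add.commute)
    then have "filterlim (\<lambda>n. \<bar>real n - y\<bar>) at_top sequentially"
      by (rule filterlim_at_top_mono) (simp add: abs_ge_self)
    then show ?thesis
      unfolding assms(4) by (rule filterlim_compose[OF assms(3)])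
  qed
  \<comment> \<open>Only one factor \<open>psi k\<close> is bounded by \<open>B\<close>; the other
    stays with \<open>lam k\<close>. This avoids dividing by \<open>lam k\<close>, which may be
    0.\<close>
  have term_lim: "(\<lambda>n. lam k * (psi k (real n))\<^sup>2) \<longlonglongrightarrow> 0" for k
  proof (rule tendsto_rabs_zero_cancel, rule tendsto_sandwich[OF _ _ tendsto_const])
    have "(\<lambda>n. lam k * psi k (real n)) \<longlonglongrightarrow> 0"
      by (rule mercer_expansion_eigenfunction_tendsto_0[OF exp assms(1) bound K_lim B])
    then show "(\<lambda>n. \<bar>lam k * psi k (real n)\<bar> * B) \<longlonglongrightarrow> 0"
      by (intro tendsto_mult_left_zero tendsto_rabs_zero)
    show "\<forall>\<^sub>F n in sequentially. \<bar>lam k * (psi k (real n))\<^sup>2\<bar> \<le> \<bar>lam k * psi k (real n)\<bar> * B"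
      using B by (intro always_eventually allI)
        (simp add: abs_mult power2_eq_square mult_left_mono flip: mult.assoc)
  qed simp
  have "summable (\<lambda>k. lam k * B\<^sup>2)"
    by (intro summable_mult2 mercer_expansion_summable_eigenvalues[OF exp assms(1) diag])
  moreover have "norm (lam k * (psi k (real n))\<^sup>2) \<le> lam k * B\<^sup>2" for k n
    using mult_left_mono[OF power_mono[OF B[of k "real n"] abs_ge_zero, of 2] lam[of k]] lam[of k]
    by (simp add: abs_mult)
  \<comment> \<open>The majorant \<open>lam k * B\<^sup>2\<close> does not depend on
    \<open>n\<close>, so limit and sum may be exchanged.\<close>
  ultimately have "(\<lambda>n. \<Sum>k. lam k * (psi k (real n))\<^sup>2) \<longlonglongrightarrow> (\<Sum>k. 0)"
    using tannerys_theorem[of "\<lambda>k n. lam k * (psi k (real n))\<^sup>2" "\<lambda>_. 0" sequentially "\<lambda>k. lam k * B\<^sup>2"]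
      term_lim by (simp add: always_eventually)
  \<comment> \<open>For every \<open>n\<close> the series sums to
    \<open>K (real n) (real n) = F 0\<close>, so a constant sequence tends to 0.\<close>
  then have "(\<lambda>n::nat. F 0) \<longlonglongrightarrow> 0"
    using sums_unique[OF mercer_expansion_diag_sums[OF exp]] by (simp add: diag)
  then have "F 0 = 0" by (simp add: LIMSEQ_const_iff)
  then show False using bound assms(6) by simp
qed

end
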